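(* Suppose $\mathbb{X}$ and $\mathbb{U}$ are compact, and let $\mathbb{M}$ be a weakly equicontinuous family of stochastic kernels from $\mathbb{X}\times\mathbb{U}$ to $\mathbb{X}$. Then $(\mathbb{M},\rho^{\mathrm{unif}}_{BL})$ is pre-compact, i.e. its closure is compact.
   Context: $\mathbb{X}$ and $\mathbb{U}$ are standard Borel (metric) spaces; $\mathbb{X}\times\mathbb{U}$ carries a product metric $d$. For $\mu,\nu\in\mathcal{P}(\mathbb{X})$ (Borel probability measures), $\rho(\mu,\nu)=\sup_{\|f\|_{BL}\le 1}|\int f\,d\mu-\int f\,d\nu|$ with $\|f\|_{BL}=\|f\|_\infty+\sup_{x\ne y}\frac{|f(x)-f(y)|}{d_{\mathbb{X}}(x,y)}$; this metrizes weak convergence. For kernels, $\rho^{\mathrm{unif}}_{BL}(M,M'):=\sup_{(x,u)\in\mathbb{X}\times\mathbb{U}}\rho(M(\cdot|x,u),M'(\cdot|x,u))$; the closure of $\mathbb{M}$ is taken in the space of all stochastic kernels from $\mathbb{X}\times\mathbb{U}$ to $\mathbb{X}$ with this metric. Weakly equicontinuous: for every $(x,u)\in\mathbb{X}\times\mathbb{U}$ and $\epsilon>0$ there is $\delta>0$ such that $d((x,u),(x',u'))<\delta$ implies $\rho(M(\cdot|x,u),M(\cdot|x',u'))\le\epsilon$ for all $M\in\mathbb{M}$. *)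

theory Defs
  imports "HOL-Probability.Probability"
begin

text \<open>The bounded-Lipschitz norm takes the value \<open>\<infinity>\<close> at functions that are unbounded or not Lipschitz.
  It is valued in \<^typ>\<open>ennreal\<close> so that the supremum over the empty set of pairs \<open>x \<noteq> y\<close>
  (a one-point space) is \<open>0\<close>.\<close>

definition BL_norm :: "('a::metric_space \<Rightarrow> real) \<Rightarrow> ennreal" where
  "BL_norm f = (SUP x. ennreal \<bar>f x\<bar>)
     + (SUP (x, y) \<in> {(x, y). x \<noteq> y}. ennreal (\<bar>f x - f y\<bar> / dist x y))"

text \<open>For Borel probability measures and for stochastic kernels the suprema below are at most \<open>2\<close>
  (see \<open>BL_dist_eq_SUP\<close>, \<open>BL_dist_unif_eq_SUP\<close>). They are formed in \<^typ>\<open>ennreal\<close> only because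
  the locale \<^locale>\<open>Metric_space\<close> wants nonnegativity also at arguments outside its carrier.\<close>

definition BL_dist :: "'a::metric_space measure \<Rightarrow> 'a measure \<Rightarrow> real" where
  "BL_dist \<mu> \<nu> = enn2real
     (SUP f \<in> {f. BL_norm f \<le> 1}. ennreal \<bar>(\<integral>x. f x \<partial>\<mu>) - (\<integral>x. f x \<partial>\<nu>)\<bar>)"

definition stochastic_kernels :: "('x::metric_space \<times> 'u::metric_space \<Rightarrow> 'x measure) set" where
  "stochastic_kernels = borel \<rightarrow>\<^sub>M prob_algebra borel"

definition BL_dist_unif ::
  "('x::metric_space \<times> 'u::metric_space \<Rightarrow> 'x measure) \<Rightarrow> ('x \<times> 'u \<Rightarrow> 'x measure) \<Rightarrow> real" where
  "BL_dist_unif M M' = enn2real (SUP (x, u). ennreal (BL_dist (M (x, u)) (M' (x, u))))"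

text \<open>The metric on the product is the library's Euclidean product metric \<open>dist_prod_def\<close>.\<close>

definition weakly_equicontinuous ::
  "('x::metric_space \<times> 'u::metric_space \<Rightarrow> 'x measure) set \<Rightarrow> bool" where
  "weakly_equicontinuous \<M> \<longleftrightarrow>
     (\<forall>x u. \<forall>\<epsilon>>0. \<exists>\<delta>>0. \<forall>x' u'. dist (x, u) (x', u') < \<delta> \<longrightarrow>
        (\<forall>M\<in>\<M>. BL_dist (M (x, u)) (M (x', u')) \<le> \<epsilon>))"

definition kernel_topology :: "('x::metric_space \<times> 'u::metric_space \<Rightarrow> 'x measure) topology" where
  "kernel_topology = Metric_space.mtopology stochastic_kernels BL_dist_unif"

lemma enn2real_SUP:
  fixes f :: "'i \<Rightarrow> real"
  assumes "I \<noteq> {}" "\<And>i. i \<in> I \<Longrightarrow> 0 \<le> f i" "\<And>i. i \<in> I \<Longrightarrow> f i \<le> c"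
  shows "enn2real (SUP i\<in>I. ennreal (f i)) = (SUP i\<in>I. f i)"
proof -
  obtain i where i: "i \<in> I" using assms(1) by blast
  have bdd: "bdd_above (f ` I)" using assms(3) by (rule bdd_aboveI2)
  have nonneg: "0 \<le> (SUP i\<in>I. f i)" using assms(2)[OF i] cSUP_upper[OF i bdd] by linarith
  have "(SUP i\<in>I. ennreal (f i)) = ennreal (SUP i\<in>I. f i)"
  proof (rule antisym)
    show "(SUP i\<in>I. ennreal (f i)) \<le> ennreal (SUP i\<in>I. f i)"
      by (intro SUP_least ennreal_leI cSUP_upper bdd)
    have "(SUP i\<in>I. ennreal (f i)) \<le> ennreal c"
      using assms(3) by (intro SUP_least ennreal_leI)
    then have top: "(SUP i\<in>I. ennreal (f i)) \<noteq> top"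
      by (metis ennreal_neq_top top_unique)
    have "(SUP i\<in>I. f i) \<le> enn2real (SUP i\<in>I. ennreal (f i))"
    proof (rule cSUP_least[OF assms(1)])
      fix j assume j: "j \<in> I"
      have "enn2real (ennreal (f j)) \<le> enn2real (SUP i\<in>I. ennreal (f i))"
        using SUP_upper[OF j, of "\<lambda>i. ennreal (f i)"] top unfolding less_top by (rule enn2real_mono)
      then show "f j \<le> enn2real (SUP i\<in>I. ennreal (f i))" using assms(2)[OF j] by simp
    qed
    then show "ennreal (SUP i\<in>I. f i) \<le> (SUP i\<in>I. ennreal (f i))"
      using top by (metis ennreal_enn2real ennreal_leI less_top)
  qed
  then show ?thesis using nonneg by simp
qed

lemma BL_norm_le_1D:
  assumes "BL_norm f \<le> 1"
  shows "\<bar>f x\<bar> \<le> 1" "\<bar>f x - f y\<bar> \<le> dist x y"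
proof -
  have "ennreal \<bar>f x\<bar> \<le> (SUP x. ennreal \<bar>f x\<bar>)" by (rule SUP_upper) simp
  also have "\<dots> \<le> BL_norm f" unfolding BL_norm_def by simp
  finally show "\<bar>f x\<bar> \<le> 1" using assms by (meson ennreal_le_1 order_trans)
  show "\<bar>f x - f y\<bar> \<le> dist x y"
  proof (cases "x = y")
    case False
    have "ennreal (\<bar>f x - f y\<bar> / dist x y)
        \<le> (SUP (x, y) \<in> {(x, y). x \<noteq> y}. ennreal (\<bar>f x - f y\<bar> / dist x y))"
      using False by (intro SUP_upper2[of "(x, y)"]) auto
    also have "\<dots> \<le> BL_norm f" unfolding BL_norm_def by simp
    finally have "\<bar>f x - f y\<bar> / dist x y \<le> 1" using assms by (meson ennreal_le_1 order_trans)
    then show ?thesis using False by (simp add: field_simps)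
  qed simp
qed

lemma BL_norm_le_1I:
  assumes "\<And>x. \<bar>f x\<bar> \<le> a" "\<And>x y. \<bar>f x - f y\<bar> \<le> b * dist x y" "a + b \<le> 1" "0 \<le> b"
  shows "BL_norm f \<le> 1"
proof -
  have a: "0 \<le> a" using assms(1)[of undefined] by linarith
  have "BL_norm f \<le> ennreal a + ennreal b"
    unfolding BL_norm_def
    using assms(1,2) by (intro add_mono SUP_least) (auto intro!: ennreal_leI simp: divide_simps)
  also have "\<dots> = ennreal (a + b)" using a assms(4) by simp
  also have "\<dots> \<le> 1" using assms(3) by simp
  finally show ?thesis .
qed

lemma BL_norm_zero: "BL_norm (\<lambda>_. 0) \<le> 1"
  by (rule BL_norm_le_1I[of _ 0 0]) auto

lemma BL_norm_le_1_continuous: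
  assumes "BL_norm f \<le> 1"
  shows "continuous_on UNIV f"
  using BL_norm_le_1D(2)[OF assms] unfolding continuous_on_iff dist_real_def
  by (metis order.strict_trans1)

lemma BL_norm_le_1_integral:
  assumes "BL_norm f \<le> 1" "\<mu> \<in> space (prob_algebra borel)"
  shows "\<bar>\<integral>x. f x \<partial>\<mu>\<bar> \<le> 1"
proof -
  have s: "sets \<mu> = sets borel" and p: "prob_space \<mu>"
    using assms(2) by (auto simp: space_prob_algebra)
  interpret prob_space \<mu> by fact
  have "f \<in> borel_measurable borel"
    using BL_norm_le_1_continuous[OF assms(1)] by (rule borel_measurable_continuous_onI)
  then have m: "f \<in> borel_measurable \<mu>" using s by (simp cong: measurable_cong_sets)
  have i: "integrable \<mu> f"
    using BL_norm_le_1D(1)[OF assms(1)] m by (intro integrable_const_bound[of _ 1]) auto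
  have "(\<integral>x. \<bar>f x\<bar> \<partial>\<mu>) \<le> (\<integral>x. 1 \<partial>\<mu>)"
    using i BL_norm_le_1D(1)[OF assms(1)] by (intro integral_mono) auto
  then show ?thesis
    using integral_abs_bound[of \<mu> f] prob_space unfolding lebesgue_integral_const
    by (smt (verit) mult_1 real_scaleR_def scaleR_one)
qed

lemma BL_norm_le_1_diff:
  assumes "BL_norm f \<le> 1" "\<mu> \<in> space (prob_algebra borel)" "\<nu> \<in> space (prob_algebra borel)"
  shows "\<bar>(\<integral>x. f x \<partial>\<mu>) - (\<integral>x. f x \<partial>\<nu>)\<bar> \<le> 2"
  using BL_norm_le_1_integral[OF assms(1,2)] BL_norm_le_1_integral[OF assms(1,3)] by linarith

lemma BL_dist_eq_SUP:
  assumes "\<mu> \<in> space (prob_algebra borel)" "\<nu> \<in> space (prob_algebra borel)"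
  shows "BL_dist \<mu> \<nu> = (SUP f \<in> {f. BL_norm f \<le> 1}. \<bar>(\<integral>x. f x \<partial>\<mu>) - (\<integral>x. f x \<partial>\<nu>)\<bar>)"
  unfolding BL_dist_def
  using BL_norm_zero BL_norm_le_1_diff[OF _ assms] by (intro enn2real_SUP[where c = 2]) auto

lemma BL_dist_upper:
  assumes "\<mu> \<in> space (prob_algebra borel)" "\<nu> \<in> space (prob_algebra borel)" "BL_norm f \<le> 1"
  shows "\<bar>(\<integral>x. f x \<partial>\<mu>) - (\<integral>x. f x \<partial>\<nu>)\<bar> \<le> BL_dist \<mu> \<nu>"
  unfolding BL_dist_eq_SUP[OF assms(1,2)]
  using assms(3) BL_norm_le_1_diff[OF _ assms(1,2)] by (intro cSUP_upper bdd_aboveI2[of _ _ 2]) auto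

lemma BL_dist_least:
  assumes "\<mu> \<in> space (prob_algebra borel)" "\<nu> \<in> space (prob_algebra borel)"
    "\<And>f. BL_norm f \<le> 1 \<Longrightarrow> \<bar>(\<integral>x. f x \<partial>\<mu>) - (\<integral>x. f x \<partial>\<nu>)\<bar> \<le> c"
  shows "BL_dist \<mu> \<nu> \<le> c"
  unfolding BL_dist_eq_SUP[OF assms(1,2)] using assms(3) BL_norm_zero by (intro cSUP_least) auto

lemma BL_dist_le_2:
  assumes "\<mu> \<in> space (prob_algebra borel)" "\<nu> \<in> space (prob_algebra borel)"
  shows "BL_dist \<mu> \<nu> \<le> 2"
  using assms BL_norm_le_1_diff[OF _ assms] by (rule BL_dist_least)

lemma BL_dist_commute: "BL_dist \<mu> \<nu> = BL_dist \<nu> \<mu>"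
  unfolding BL_dist_def by (simp add: abs_minus_commute)

lemma BL_dist_self: "BL_dist \<mu> \<mu> = 0"
  unfolding BL_dist_def by (simp add: SUP_constant bot_ennreal)

lemma BL_dist_nonneg: "0 \<le> BL_dist \<mu> \<nu>"
  unfolding BL_dist_def by simp

lemma BL_dist_triangle:
  assumes "\<mu> \<in> space (prob_algebra borel)" "\<nu> \<in> space (prob_algebra borel)"
    "\<kappa> \<in> space (prob_algebra borel)"
  shows "BL_dist \<mu> \<kappa> \<le> BL_dist \<mu> \<nu> + BL_dist \<nu> \<kappa>"
proof (rule BL_dist_least[OF assms(1,3)])
  fix f :: "'a \<Rightarrow> real" assume "BL_norm f \<le> 1"
  from BL_dist_upper[OF assms(1,2) this] BL_dist_upper[OF assms(2,3) this]
  show "\<bar>(\<integral>x. f x \<partial>\<mu>) - (\<integral>x. f x \<partial>\<kappa>)\<bar> \<le> BL_dist \<mu> \<nu> + BL_dist \<nu> \<kappa>" by linarith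
qed

lemma closed_approx_integral:
  fixes C :: "'a::metric_space set"
  assumes "closed C" "C \<noteq> {}" "\<mu> \<in> space (prob_algebra borel)"
  shows "(\<lambda>n. \<integral>x. max 0 (1 - real n * infdist x C) \<partial>\<mu>) \<longlonglongrightarrow> measure \<mu> C"
proof -
  have s: "sets \<mu> = sets borel" and p: "prob_space \<mu>"
    using assms(3) by (auto simp: space_prob_algebra)
  interpret prob_space \<mu> by fact
  have C: "C \<in> sets \<mu>" using s assms(1) by simp
  have m: "(\<lambda>x. max 0 (1 - real n * infdist x C)) \<in> borel_measurable \<mu>" for n
  proof -
    have "(\<lambda>x. max 0 (1 - real n * infdist x C)) \<in> borel_measurable borel"
      by (intro borel_measurable_continuous_onI continuous_intros)
    then show ?thesis using s by (simp cong: measurable_cong_sets)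
  qed
  have "(\<lambda>n. \<integral>x. max 0 (1 - real n * infdist x C) \<partial>\<mu>) \<longlonglongrightarrow> (\<integral>x. indicator C x \<partial>\<mu>)"
  proof (rule integral_dominated_convergence[where w = "\<lambda>_. 1"])
    show "AE x in \<mu>. (\<lambda>n. max 0 (1 - real n * infdist x C)) \<longlonglongrightarrow> indicator C x"
    proof (rule AE_I2)
      fix x
      show "(\<lambda>n. max 0 (1 - real n * infdist x C)) \<longlonglongrightarrow> (indicator C x :: real)"
      proof (cases "x \<in> C")
        case False
        then have pos: "0 < infdist x C" using infdist_pos_not_in_closed assms(1,2) by blast
        then have "eventually (\<lambda>n. 1 < real n * infdist x C) sequentially"
          by real_asymp
        then have "eventually (\<lambda>n. max 0 (1 - real n * infdist x C) = 0) sequentially"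
          by eventually_elim simp
        then show ?thesis using False by (simp add: tendsto_eventually)
      qed simp
    qed
    show "AE x in \<mu>. norm (max 0 (1 - real n * infdist x C)) \<le> 1" for n
      by (simp add: infdist_nonneg)
  qed (use C m in auto)
  then show ?thesis using C by simp
qed

lemma BL_dist_eq_0D:
  assumes \<mu>: "\<mu> \<in> space (prob_algebra borel)" and \<nu>: "\<nu> \<in> space (prob_algebra borel)"
    and 0: "BL_dist \<mu> \<nu> = 0"
  shows "\<mu> = \<nu>"
proof (rule measure_eqI_generator_eq[where E = "{C. closed C}" and \<Omega> = UNIV and A = "\<lambda>_. UNIV"])
  have s: "sets \<mu> = sets borel" "sets \<nu> = sets borel" and p: "prob_space \<mu>" "prob_space \<nu>"
    using \<mu> \<nu> by (auto simp: space_prob_algebra)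
  have "sets (borel :: 'a measure) = sigma_sets UNIV {C. closed C}"
    unfolding borel_eq_closed by (rule sets_measure_of) simp
  then show "sets \<mu> = sigma_sets UNIV {C. closed C}" "sets \<nu> = sigma_sets UNIV {C. closed C}"
    using s by auto
  show "emeasure \<mu> UNIV \<noteq> \<infinity>"
    using p(1) by (simp add: finite_measure.emeasure_finite prob_space.finite_measure)
  show "Int_stable {C. closed C}" by (auto simp: Int_stable_def)
  fix C :: "'a set" assume "C \<in> {C. closed C}"
  then have C: "closed C" by simp
  show "emeasure \<mu> C = emeasure \<nu> C"
  proof (cases "C = {}")
    case False
    have "(\<integral>x. max 0 (1 - real n * infdist x C) \<partial>\<mu>) = (\<integral>x. max 0 (1 - real n * infdist x C) \<partial>\<nu>)" for n
    proof -
      define g where "g = (\<lambda>x. max 0 (1 - real n * infdist x C) / (real n + 1))"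
      have "BL_norm g \<le> 1"
      proof (rule BL_norm_le_1I[of _ "1 / (real n + 1)" "real n / (real n + 1)"])
        show "\<bar>g x\<bar> \<le> 1 / (real n + 1)" for x
          unfolding g_def by (auto simp: divide_simps infdist_nonneg)
        show "\<bar>g x - g y\<bar> \<le> real n / (real n + 1) * dist x y" for x y
        proof -
          have "real n * \<bar>infdist x C - infdist y C\<bar> \<le> real n * dist x y"
            by (intro mult_left_mono infdist_triangle_abs) auto
          then have "\<bar>real n * infdist x C - real n * infdist y C\<bar> \<le> real n * dist x y"
            by (metis abs_mult abs_of_nat right_diff_distrib)
          then have "\<bar>max 0 (1 - real n * infdist x C) - max 0 (1 - real n * infdist y C)\<bar>
              \<le> real n * dist x y"
            by linarith
          moreover have "\<bar>g x - g y\<bar> = \<bar>max 0 (1 - real n * infdist x C)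
              - max 0 (1 - real n * infdist y C)\<bar> / (real n + 1)"
            unfolding g_def by (simp add: diff_divide_distrib[symmetric] abs_divide)
          ultimately show ?thesis by (simp add: divide_right_mono)
        qed
        show "1 / (real n + 1) + real n / (real n + 1) \<le> 1"
          by (simp add: add_divide_distrib[symmetric])
      qed simp
      from BL_dist_upper[OF \<mu> \<nu> this] have "(\<integral>x. g x \<partial>\<mu>) = (\<integral>x. g x \<partial>\<nu>)" using 0 by simp
      then show ?thesis unfolding g_def by simp
    qed
    then have "measure \<mu> C = measure \<nu> C"
      using closed_approx_integral[OF C False \<mu>] closed_approx_integral[OF C False \<nu>]
      by (simp add: LIMSEQ_unique)
    then show ?thesis
      using p by (simp add: finite_measure.emeasure_eq_measure prob_space.finite_measure)
  qed simp
qed auto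

lemma stochastic_kernels_space:
  assumes "M \<in> stochastic_kernels"
  shows "M z \<in> space (prob_algebra borel)"
  using assms unfolding stochastic_kernels_def by (auto dest: measurable_space)

lemma BL_dist_unif_eq_SUP:
  assumes "M \<in> stochastic_kernels" "M' \<in> stochastic_kernels"
  shows "BL_dist_unif M M' = (SUP (x, u). BL_dist (M (x, u)) (M' (x, u)))"
proof -
  have "enn2real (SUP z. ennreal (BL_dist (M z) (M' z))) = (SUP z. BL_dist (M z) (M' z))"
    using BL_dist_nonneg
      BL_dist_le_2[OF stochastic_kernels_space[OF assms(1)] stochastic_kernels_space[OF assms(2)]]
    by (intro enn2real_SUP[where c = 2]) auto
  then show ?thesis unfolding BL_dist_unif_def by (simp add: case_prod_unfold)
qed

lemma BL_dist_unif_upper: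
  assumes "M \<in> stochastic_kernels" "M' \<in> stochastic_kernels"
  shows "BL_dist (M z) (M' z) \<le> BL_dist_unif M M'"
proof -
  have "bdd_above (range (\<lambda>z. BL_dist (M z) (M' z)))"
    using BL_dist_le_2[OF stochastic_kernels_space[OF assms(1)] stochastic_kernels_space[OF assms(2)]]
    by (intro bdd_aboveI2[of _ _ 2])
  then show ?thesis
    unfolding BL_dist_unif_eq_SUP[OF assms] by (auto simp: case_prod_unfold intro: cSUP_upper)
qed

lemma BL_dist_unif_least:
  assumes "M \<in> stochastic_kernels" "M' \<in> stochastic_kernels" "\<And>z. BL_dist (M z) (M' z) \<le> c"
  shows "BL_dist_unif M M' \<le> c"
  unfolding BL_dist_unif_eq_SUP[OF assms(1,2)] using assms(3) by (intro cSUP_least) auto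

lemma Metric_space_BL_dist: "Metric_space (space (prob_algebra borel)) BL_dist"
  by unfold_locales
    (auto simp: BL_dist_nonneg BL_dist_self
      intro: BL_dist_commute BL_dist_eq_0D BL_dist_triangle)

lemma Metric_space_BL_dist_unif: "Metric_space stochastic_kernels BL_dist_unif"
proof
  fix M M' M'' :: "'a \<times> 'b \<Rightarrow> 'a measure"
  show "0 \<le> BL_dist_unif M M'" unfolding BL_dist_unif_def by simp
  show "BL_dist_unif M M' = BL_dist_unif M' M"
    unfolding BL_dist_unif_def by (subst BL_dist_commute) (rule refl)
  assume M: "M \<in> stochastic_kernels" and M': "M' \<in> stochastic_kernels"
  show "BL_dist_unif M M' = 0 \<longleftrightarrow> M = M'"
  proof
    assume 0: "BL_dist_unif M M' = 0"
    show "M = M'"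
    proof
      fix z
      have "BL_dist (M z) (M' z) = 0"
        using BL_dist_unif_upper[OF M M', of z] BL_dist_nonneg[of "M z" "M' z"] 0 by linarith
      then show "M z = M' z"
        by (rule BL_dist_eq_0D[OF stochastic_kernels_space[OF M] stochastic_kernels_space[OF M']])
    qed
  next
    assume "M = M'"
    then show "BL_dist_unif M M' = 0"
      unfolding BL_dist_unif_def by (simp add: BL_dist_self case_prod_unfold)
  qed
  assume M'': "M'' \<in> stochastic_kernels"
  show "BL_dist_unif M M'' \<le> BL_dist_unif M M' + BL_dist_unif M' M''"
  proof (rule BL_dist_unif_least[OF M M''])
    fix z
    show "BL_dist (M z) (M'' z) \<le> BL_dist_unif M M' + BL_dist_unif M' M''"
      using BL_dist_triangle[OF stochastic_kernels_space[OF M] stochastic_kernels_space[OF M']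
          stochastic_kernels_space[OF M''], of z z z]
        BL_dist_unif_upper[OF M M', of z] BL_dist_unif_upper[OF M' M'', of z] by linarith
  qed
qed

end

theory Submission
  imports Defs
begin

text \<open>Arzela--Ascoli, with values in the space of probability measures on \<open>\<bbbX>\<close>. That space is totally
  bounded, because a measure is determined up to \<open>\<epsilon>\<close> by its rounded masses on finitely many small
  cells. It is complete because a compact metric space has a Borel code in \<open>[0, 2]\<close> (ternary digits
  recording membership in a countable base) whose inverse is uniformly continuous, hence extends
  continuously to the closure of the set of codes. Measures are transported along the code to the
  real line, where Helly's selection theorem gives a weak limit, and this limit is transported back.\<close>

section \<open>Weak sequential compactness of the space of probability measures\<close>

text \<open>The first differing digit contributes \<open>(1/3) ^ m\<close>, while all later digits
  together change the sum by at most half of that, so half survives. In base 2 the tail could cancel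
  the leading difference completely.\<close>

lemma ternary_expansion_gap:
  fixes a b :: "nat \<Rightarrow> bool"
  assumes "a m \<noteq> b m" "\<And>k. k < m \<Longrightarrow> a k = b k"
  shows "(1/3) ^ m / 2 \<le> \<bar>(\<Sum>k. of_bool (a k) * (1/3::real) ^ k) - (\<Sum>k. of_bool (b k) * (1/3) ^ k)\<bar>"
proof -
  define c :: "nat \<Rightarrow> real" where "c k = (of_bool (a k) - of_bool (b k)) * (1/3) ^ k" for k
  have geo: "summable (\<lambda>k. (1/3::real) ^ k)" by (rule summable_geometric) simp
  have sm: "summable (\<lambda>k. of_bool (p k) * (1/3::real) ^ k)" for p :: "nat \<Rightarrow> bool"
    by (rule summable_comparison_test'[OF geo, of 0]) auto
  have eq: "(\<Sum>k. of_bool (a k) * (1/3::real) ^ k) - (\<Sum>k. of_bool (b k) * (1/3) ^ k) = suminf c"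
    unfolding c_def using suminf_diff[OF sm sm, of a b] by (simp add: left_diff_distrib)
  have cb: "\<bar>c k\<bar> \<le> (1/3) ^ k" for k unfolding c_def by (auto simp: abs_mult)
  have sc: "summable c" by (rule summable_comparison_test'[OF geo, of 0]) (use cb in auto)
  have head: "(\<Sum>i<Suc m. c i) = c m"
    using assms(2) by (simp add: c_def)
  have cm: "\<bar>c m\<bar> = (1/3) ^ m" using assms(1) by (auto simp: c_def abs_mult)
  have "(\<lambda>k. (1/3) ^ Suc m * (1/3::real) ^ k) sums ((1/3) ^ Suc m * (1 / (1 - 1/3)))"
    by (intro sums_mult geometric_sums) simp
  then have tl: "(\<lambda>k. (1/3::real) ^ (k + Suc m)) sums ((1/3) ^ m / 2)"
    by (simp add: power_add mult_ac)
  have "\<bar>\<Sum>k. c (k + Suc m)\<bar> \<le> (\<Sum>k. (1/3::real) ^ (k + Suc m))"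
    unfolding real_norm_def[symmetric]
    by (intro norm_suminf_le sums_summable[OF tl]) (simp only: real_norm_def cb)
  then have "\<bar>\<Sum>k. c (k + Suc m)\<bar> \<le> (1/3) ^ m / 2" using tl by (simp add: sums_iff)
  then show ?thesis
    unfolding eq suminf_split_initial_segment[OF sc, of "Suc m"] head using cm by linarith
qed

text \<open>The digits are indicators of open sets, so \<open>s\<close> is Borel but in general
  discontinuous. Only its inverse is well behaved: the last property expresses injectivity together
  with uniform continuity of the inverse. The series is at most 3/2, and 2 is a convenient round
  bound.\<close>

lemma compact_borel_code:
  assumes comp: "compact (UNIV :: 'a::{metric_space, second_countable_topology} set)"
  obtains s :: "'a::{metric_space, second_countable_topology} \<Rightarrow> real" where "s \<in> borel_measurable borel" "\<And>x. s x \<in> {0..2}"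
    "\<And>e. e > 0 \<Longrightarrow> \<exists>d>0. \<forall>x y. \<bar>s x - s y\<bar> < d \<longrightarrow> dist x y < e"
proof -
  obtain \<B> :: "'a set set" where \<B>: "countable \<B>" "topological_basis \<B>"
    using ex_countable_basis by blast
  have "\<B> \<noteq> {}" using topological_basisE[OF \<B>(2) open_UNIV UNIV_I] by blast
  define B where "B = from_nat_into \<B>"
  have B: "range B = \<B>" unfolding B_def using \<open>\<B> \<noteq> {}\<close> \<B>(1) by (rule range_from_nat_into)
  have oB: "open (B k)" for k using B topological_basis_open[OF \<B>(2)] by blast
  have [measurable]: "B k \<in> sets borel" for k using oB by simp
  define s :: "'a \<Rightarrow> real" where "s x = (\<Sum>k. of_bool (x \<in> B k) * (1/3) ^ k)" for x
  have geo: "(\<lambda>k. (1/3::real) ^ k) sums (1 / (1 - 1/3))" by (rule geometric_sums) simp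
  have sm: "summable (\<lambda>k. of_bool (x \<in> B k) * (1/3::real) ^ k)" for x
    by (rule summable_comparison_test'[OF sums_summable[OF geo], of 0]) auto
  show ?thesis
  proof (rule that[of s])
    show "s \<in> borel_measurable borel"
      unfolding s_def by (intro borel_measurable_suminf) measurable
    show "s x \<in> {0..2}" for x
    proof -
      have "s x \<le> (\<Sum>k. (1/3::real) ^ k)"
        unfolding s_def using sums_summable[OF geo] sm by (intro suminf_le) auto
      then have "s x \<le> 2" using geo by (simp add: sums_iff)
      moreover have "0 \<le> s x" unfolding s_def using sm by (intro suminf_nonneg) auto
      ultimately show ?thesis by simp
    qed
    fix e :: real assume "e > 0"
    \<comment> \<open>Finitely many base sets of diameter below \<open>e\<close> cover the space, and \<open>s\<close>-close points have the same
      leading digits, hence lie in a common one of them.\<close>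
    define I where "I = {k. \<forall>x\<in>B k. \<forall>y\<in>B k. dist x y < e}"
    have "UNIV \<subseteq> (\<Union>k\<in>I. B k)"
    proof
      fix x :: 'a
      obtain U where U: "U \<in> \<B>" "x \<in> U" "U \<subseteq> ball x (e/2)"
        using topological_basisE[OF \<B>(2) open_ball, of x x "e/2"] \<open>e > 0\<close> by auto
      then obtain k where k: "U = B k" using B by auto
      have "dist y z < e" if "y \<in> U" "z \<in> U" for y z
        using dist_triangle_half_r[of x y e z] that U(3) by (auto simp: subset_iff)
      then show "x \<in> (\<Union>k\<in>I. B k)" using U k by (auto simp: I_def)
    qed
    then obtain J where J: "J \<subseteq> I" "finite J" "UNIV \<subseteq> (\<Union>k\<in>J. B k)"
      using compactE_image[OF comp, of I B] oB by blast
    obtain n where n: "\<And>k. k \<in> J \<Longrightarrow> k < n"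
      using J(2) unfolding finite_nat_set_iff_bounded by blast
    show "\<exists>d>0. \<forall>x y. \<bar>s x - s y\<bar> < d \<longrightarrow> dist x y < e"
    \<comment> \<open>If the digits differ somewhere below \<open>n\<close>, the first difference
      \<open>m\<close> is also below \<open>n\<close>, and the gap \<open>(1/3) ^ m / 2\<close> is
      at least this witness.\<close>
    proof (intro exI[of _ "(1/3) ^ n / 2"] conjI allI impI)
      fix x y assume less: "\<bar>s x - s y\<bar> < (1/3) ^ n / 2"
      have agree: "x \<in> B k \<longleftrightarrow> y \<in> B k" if "k < n" for k
      proof (rule ccontr)
        assume ne: "(x \<in> B k) \<noteq> (y \<in> B k)"
        define m where "m = (LEAST k. (x \<in> B k) \<noteq> (y \<in> B k))"
        have m: "(x \<in> B m) \<noteq> (y \<in> B m)" unfolding m_def using ne by (rule LeastI)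
        have "m \<le> k" unfolding m_def using ne by (rule Least_le)
        have "(1/3) ^ m / 2 \<le> \<bar>s x - s y\<bar>"
          unfolding s_def
        proof (rule ternary_expansion_gap[where a = "\<lambda>k. x \<in> B k" and b = "\<lambda>k. y \<in> B k" and m = m, OF m])
          show "(x \<in> B j) = (y \<in> B j)" if "j < m" for j
            using not_less_Least[OF that[unfolded m_def]] by simp
        qed
        moreover have "(1/3::real) ^ n \<le> (1/3) ^ m"
          using \<open>m \<le> k\<close> that by (intro power_decreasing) auto
        ultimately show False using less by linarith
      qed
      obtain k where "k \<in> J" "x \<in> B k" using J(3) by blast
      then show "dist x y < e" using agree[OF n] J(1) by (auto simp: I_def)
    qed simp
  qed
qed

lemma bounded_measurable_integrable:
  fixes f :: "'a::metric_space \<Rightarrow> real"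
  assumes "\<mu> \<in> space (prob_algebra borel)" "f \<in> borel_measurable borel" "\<And>x. \<bar>f x\<bar> \<le> c"
  shows "integrable \<mu> f"
proof -
  have s: "sets \<mu> = sets borel" and "prob_space \<mu>"
    using assms(1) by (auto simp: space_prob_algebra)
  interpret prob_space \<mu> by fact
  show ?thesis
    using assms(2,3) s by (intro integrable_const_bound[of _ c]) (auto cong: measurable_cong_sets)
qed

section \<open>Weak limits on the real line and their transport back\<close>

text \<open>The functions \<open>max 0 (1 - real m * infdist t K)\<close> are bounded, continuous
  and equal to 1 on \<open>K\<close>, so their integrals are 1 under each \<open>\<mu> n\<close> and
  hence under \<open>M\<close>. As \<open>m\<close> grows they decrease to the indicator of
  \<open>K\<close>, which gives \<open>K\<close> full mass under \<open>M\<close>.\<close>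

lemma weak_limit_concentrated:
  fixes M :: "real measure"
  assumes "closed K" "\<And>n. real_distribution (\<mu> n)" "real_distribution M" "weak_conv_m \<mu> M"
    "\<And>n. AE t in \<mu> n. t \<in> K"
  shows "AE t in M. t \<in> K"
proof -
  interpret M: real_distribution M by fact
  interpret \<mu>: real_distribution "\<mu> n" for n by fact
  have [measurable]: "(\<lambda>t. infdist t K) \<in> borel_measurable borel"
    by (intro borel_measurable_continuous_onI continuous_intros)
  \<comment> \<open>The distance to the empty set is 0 by convention, so the approximation of the
    indicator is available for nonempty sets only.\<close>
  have "K \<noteq> {}"
    using assms(5)[of 0] \<mu>.AE_False[of 0] by auto
  have pM: "M \<in> space (prob_algebra borel)"
    by (simp add: space_prob_algebra M.prob_space_axioms)
  have "(\<integral>t. max 0 (1 - real m * infdist t K) \<partial>M) = 1" for m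
  proof (rule LIMSEQ_unique)
    show "(\<lambda>n. \<integral>t. max 0 (1 - real m * infdist t K) \<partial>\<mu> n) \<longlonglongrightarrow> (\<integral>t. max 0 (1 - real m * infdist t K) \<partial>M)"
    proof (rule weak_conv_imp_integral_bdd_continuous_conv[OF assms(2-4)])
      show "isCont (\<lambda>t. max 0 (1 - real m * infdist t K)) x" for x
        by (intro continuous_intros)
      show "norm (max 0 (1 - real m * infdist x K)) \<le> 1" for x
        by (simp add: infdist_nonneg)
    qed
    have "(\<integral>t. max 0 (1 - real m * infdist t K) \<partial>\<mu> n) = (\<integral>t. 1 \<partial>\<mu> n)" for n
      by (intro integral_cong_AE) (use assms(5)[of n] in auto)
    then show "(\<lambda>n. \<integral>t. max 0 (1 - real m * infdist t K) \<partial>\<mu> n) \<longlonglongrightarrow> 1"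
      using \<mu>.prob_space by simp
  qed
  then have "measure M K = 1"
    using closed_approx_integral[OF assms(1) \<open>K \<noteq> {}\<close> pM] by (simp add: LIMSEQ_const_iff)
  then show ?thesis using assms(1) by (intro M.AE_prob_1)
qed

text \<open>The common interval has mass 1 under every measure and so serves for all
  \<open>\<epsilon>\<close>. It cannot be empty, since a probability measure is concentrated on
  it.\<close>

lemma tight_of_bounded_support:
  assumes "\<And>n. real_distribution (\<mu> n)" "\<And>n. AE t in \<mu> n. t \<in> {a<..b}"
  shows "tight \<mu>"
  unfolding tight_def
proof (intro conjI allI impI assms(1))
  fix \<epsilon> :: real assume "\<epsilon> > 0"
  interpret real_distribution "\<mu> n" for n by fact
  have "measure (\<mu> n) {a<..b} = 1" for n using assms(2)[of n] by (subst prob_eq_1) auto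
  moreover have "a < b"
  proof (rule ccontr)
    assume "\<not> a < b"
    then show False using assms(2)[of 0] AE_False[of 0] by auto
  qed
  ultimately show "\<exists>a b. a < b \<and> (\<forall>n. 1 - \<epsilon> < measure (\<mu> n) {a<..b})"
    using \<open>\<epsilon> > 0\<close> by (intro exI[of _ a] exI[of _ b]) auto
qed

text \<open>Discontinuity of \<open>s\<close> does no harm: a continuous test function
  \<open>f\<close> becomes \<open>f (g t)\<close> on the line, which is continuous on the closed set
  \<open>K\<close> because the extended inverse \<open>g\<close> is. Completeness of the space
  enters through that extension.\<close>

lemma prob_algebra_weak_subseq:
  fixes \<mu> :: "nat \<Rightarrow> 'a::polish_space measure"
  assumes comp: "compact (UNIV :: 'a set)" and \<mu>: "\<And>n. \<mu> n \<in> space (prob_algebra borel)"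
  obtains r \<nu> where "strict_mono r" "\<nu> \<in> space (prob_algebra borel)"
    "\<And>f :: 'a \<Rightarrow> real. continuous_on UNIV f \<Longrightarrow> (\<lambda>n. \<integral>x. f x \<partial>\<mu> (r n)) \<longlonglongrightarrow> (\<integral>x. f x \<partial>\<nu>)"
proof -
  obtain s :: "'a \<Rightarrow> real" where s[measurable]: "s \<in> borel_measurable borel"
    and s_range: "\<And>x. s x \<in> {0..2}"
    and s_inv: "\<And>e. e > 0 \<Longrightarrow> \<exists>d>0. \<forall>x y. \<bar>s x - s y\<bar> < d \<longrightarrow> dist x y < e"
    by (rule compact_borel_code[OF comp]) (rule that)
  have inj: "inj s"
  proof (rule injI)
    fix x y assume "s x = s y"
    then have "dist x y < e" if "e > 0" for e using s_inv[OF that] by auto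
    then show "x = y" by (metis dist_pos_lt less_irrefl)
  qed
  have uc: "uniformly_continuous_on (range s) (inv s)"
    unfolding uniformly_continuous_on_def dist_real_def
    by (simp add: inj) (metis s_inv)
  \<comment> \<open>A weak limit may charge points of the closure that code no point of the space,
    so the inverse must be defined there as well.\<close>
  obtain g :: "real \<Rightarrow> 'a" where "uniformly_continuous_on (closure (range s)) g"
    and gs': "\<And>t. t \<in> range s \<Longrightarrow> inv s t = g t"
    by (rule uniformly_continuous_on_extension_on_closure[OF uc]) (rule that)
  define K where "K = closure (range s)"
  have cg: "continuous_on K g" unfolding K_def by (rule uniformly_continuous_imp_continuous) fact
  have gs: "g (s x) = x" for x using gs'[of "s x"] inj by simp
  have sK: "s x \<in> K" for x unfolding K_def using closure_subset[of "range s"] by blast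
  have K: "closed K" unfolding K_def by simp

  have sets[simp, measurable_cong]: "sets (\<mu> n) = sets borel" and prob: "prob_space (\<mu> n)" for n
    using \<mu>[of n] by (auto simp: space_prob_algebra)
  define \<rho> where "\<rho> n = distr (\<mu> n) borel s" for n
  have \<rho>: "real_distribution (\<rho> n)" for n
    unfolding \<rho>_def by (rule prob_space.real_distribution_distr[OF prob]) measurable
  have supp: "AE t in \<rho> n. t \<in> {-1<..2}" for n
  proof -
    \<comment> \<open>Tightness is phrased with intervals open on the left; as
      \<open>s_range\<close> admits the code 0, the left end is moved to -1.\<close>
    have "s x \<in> {-1<..2}" for x using s_range[of x] by simp
    then show ?thesis unfolding \<rho>_def by (subst AE_distr_iff) simp_all
  qed
  have "tight \<rho>" by (rule tight_of_bounded_support) (rule \<rho> supp)+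
  \<comment> \<open>Helly selection, applied to the whole sequence as a subsequence of
    itself.\<close>
  from tight_imp_convergent_subsubsequence[OF this strict_mono_id]
  obtain r M where r: "strict_mono r" and M: "real_distribution M" and conv: "weak_conv_m (\<rho> \<circ> r) M"
    by auto
  interpret M: real_distribution M by fact
  have MK: "AE t in M. t \<in> K"
  proof (rule weak_limit_concentrated[OF K _ M conv])
    show "real_distribution ((\<rho> \<circ> r) n)" for n using \<rho> by simp
    show "AE t in (\<rho> \<circ> r) n. t \<in> K" for n
      unfolding \<rho>_def comp_def using sK K by (subst AE_distr_iff) auto
  qed
  \<comment> \<open>The constant value off \<open>K\<close> makes \<open>h\<close> Borel on the
    whole line; it does not affect integrals, because \<open>M\<close> is concentrated on
    \<open>K\<close>.\<close>
  define h where "h t = (if t \<in> K then g t else undefined)" for t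
  have h[measurable]: "h \<in> borel_measurable borel"
    unfolding h_def using K cg by (intro borel_measurable_continuous_on_if) auto
  define \<nu> where "\<nu> = distr M borel h"
  show ?thesis
  proof (rule that[OF r, of \<nu>])
    show "\<nu> \<in> space (prob_algebra borel)"
      unfolding \<nu>_def space_prob_algebra by (simp add: M.prob_space_distr)
    fix f :: "'a \<Rightarrow> real" assume f: "continuous_on UNIV f"
    have [measurable]: "f \<in> borel_measurable borel" using f by (rule borel_measurable_continuous_onI)
    have "bounded (range f)"
      using comp f by (intro compact_imp_bounded compact_continuous_image)
    then obtain B where B: "\<And>x. \<bar>f x\<bar> \<le> B" by (auto simp: bounded_iff)
    have "0 \<le> B" using order_trans[OF abs_ge_zero B] .
    have "continuous_on K (\<lambda>t. f (g t))"
      using continuous_on_compose2[OF f cg] by auto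
    moreover have "closedin (top_of_set UNIV) K" by (rule closed_subset[OF subset_UNIV K])
    moreover have "norm (f (g t)) \<le> B" for t using B by simp
    \<comment> \<open>Weak convergence on the line tests bounded continuous functions on all of it,
      so \<open>f (g t)\<close> is extended from \<open>K\<close> with the same bound. On codes,
      \<open>F (s x) = f x\<close>.\<close>
    ultimately obtain F where F: "continuous_on UNIV F" "\<And>t. t \<in> K \<Longrightarrow> F t = f (g t)" "\<And>t. norm (F t) \<le> B"
      using Tietze[of K "\<lambda>t. f (g t)" UNIV B, OF _ _ \<open>0 \<le> B\<close>] by (metis UNIV_I)
    have [measurable]: "F \<in> borel_measurable borel" using F(1) by (rule borel_measurable_continuous_onI)
    have "(\<lambda>n. \<integral>t. F t \<partial>(\<rho> \<circ> r) n) \<longlonglongrightarrow> (\<integral>t. F t \<partial>M)"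
      using F \<rho> by (intro weak_conv_imp_integral_bdd_continuous_conv[OF _ M conv])
        (auto simp: continuous_on_eq_continuous_at)
    moreover have "(\<integral>t. F t \<partial>(\<rho> \<circ> r) n) = (\<integral>x. f x \<partial>\<mu> (r n))" for n
      unfolding \<rho>_def comp_def by (subst integral_distr) (auto simp: F(2) sK gs)
    moreover have "(\<integral>t. F t \<partial>M) = (\<integral>x. f x \<partial>\<nu>)"
    proof -
      have "AE t in M. F t = f (h t)" using MK by eventually_elim (simp add: F(2) h_def)
      then have "(\<integral>t. F t \<partial>M) = (\<integral>t. f (h t) \<partial>M)" by (intro integral_cong_AE) measurable
      then show ?thesis unfolding \<nu>_def by (subst integral_distr) auto
    qed
    ultimately show "(\<lambda>n. \<integral>x. f x \<partial>\<mu> (r n)) \<longlonglongrightarrow> (\<integral>x. f x \<partial>\<nu>)" by simp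
  qed
qed

section \<open>Completeness\<close>

text \<open>The weak limit of a subsequence is the limit of the whole Cauchy sequence: for a fixed
  test function the estimate between \<open>\<mu> m\<close> and \<open>\<mu> (r n)\<close> passes to
  the limit in \<open>n\<close>, with a bound that is the same for all test functions of norm at
  most 1.\<close>

lemma BL_dist_complete:
  fixes \<mu> :: "nat \<Rightarrow> 'a::polish_space measure"
  assumes comp: "compact (UNIV :: 'a set)" and \<mu>: "\<And>n. \<mu> n \<in> space (prob_algebra borel)"
    and cauchy: "\<And>e. e > 0 \<Longrightarrow> \<exists>N. \<forall>m\<ge>N. \<forall>n\<ge>N. BL_dist (\<mu> m) (\<mu> n) < e"
  obtains \<nu> where "\<nu> \<in> space (prob_algebra borel)" "(\<lambda>n. BL_dist (\<mu> n) \<nu>) \<longlonglongrightarrow> 0"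
proof -
  obtain r \<nu> where r: "strict_mono r" and \<nu>: "\<nu> \<in> space (prob_algebra borel)"
    and lim: "\<And>f :: 'a \<Rightarrow> real. continuous_on UNIV f \<Longrightarrow> (\<lambda>n. \<integral>x. f x \<partial>\<mu> (r n)) \<longlonglongrightarrow> (\<integral>x. f x \<partial>\<nu>)"
    by (rule prob_algebra_weak_subseq[of \<mu>, OF comp \<mu>]) (rule that)
  have "(\<lambda>n. BL_dist (\<mu> n) \<nu>) \<longlonglongrightarrow> 0"
  proof (rule LIMSEQ_I)
    fix e :: real assume "e > 0"
    then obtain N where N: "\<And>m n. m \<ge> N \<Longrightarrow> n \<ge> N \<Longrightarrow> BL_dist (\<mu> m) (\<mu> n) < e / 2"
      using cauchy[of "e / 2"] by auto
    have "BL_dist (\<mu> m) \<nu> \<le> e / 2" if "m \<ge> N" for m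
    proof (rule BL_dist_least[OF \<mu> \<nu>])
      fix f :: "'a \<Rightarrow> real" assume f: "BL_norm f \<le> 1"
      have "(\<lambda>n. \<bar>(\<integral>x. f x \<partial>\<mu> m) - (\<integral>x. f x \<partial>\<mu> (r n))\<bar>) \<longlonglongrightarrow> \<bar>(\<integral>x. f x \<partial>\<mu> m) - (\<integral>x. f x \<partial>\<nu>)\<bar>"
        by (intro tendsto_intros lim BL_norm_le_1_continuous f)
      moreover have "\<bar>(\<integral>x. f x \<partial>\<mu> m) - (\<integral>x. f x \<partial>\<mu> (r n))\<bar> \<le> e / 2" if "n \<ge> N" for n
        using BL_dist_upper[OF \<mu> \<mu> f, of m "r n"] N[OF \<open>m \<ge> N\<close>, of "r n"]
          le_trans[OF that strict_mono_imp_increasing[OF r]] by linarith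
      ultimately show "\<bar>(\<integral>x. f x \<partial>\<mu> m) - (\<integral>x. f x \<partial>\<nu>)\<bar> \<le> e / 2"
        by (intro LIMSEQ_le_const2) auto
    qed
    then have "BL_dist (\<mu> m) \<nu> < e" if "m \<ge> N" for m
      using that \<open>e > 0\<close> by fastforce
    then show "\<exists>no. \<forall>n\<ge>no. norm (BL_dist (\<mu> n) \<nu> - 0) < e"
      by (auto simp: BL_dist_nonneg)
  qed
  with \<nu> show ?thesis by (rule that)
qed

section \<open>Limits of kernels\<close>

lemma BL_dist_tendsto_integral:
  fixes f :: "'a::metric_space \<Rightarrow> real"
  assumes "\<And>n. \<mu> n \<in> space (prob_algebra borel)" "\<nu> \<in> space (prob_algebra borel)"
    "(\<lambda>n. BL_dist (\<mu> n) \<nu>) \<longlonglongrightarrow> 0" "BL_norm f \<le> 1"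
  shows "(\<lambda>n. \<integral>x. f x \<partial>\<mu> n) \<longlonglongrightarrow> (\<integral>x. f x \<partial>\<nu>)"
proof (rule LIM_zero_cancel, rule Lim_null_comparison[OF _ assms(3)])
  show "\<forall>\<^sub>F n in sequentially. norm ((\<integral>x. f x \<partial>\<mu> n) - (\<integral>x. f x \<partial>\<nu>)) \<le> BL_dist (\<mu> n) \<nu>"
    unfolding real_norm_def using BL_dist_upper[OF assms(1,2,4)] by (intro always_eventually allI)
qed

text \<open>These functions are bounded by 1 and \<open>k\<close>-Lipschitz, so the factor
  \<open>1 / (1 + real k)\<close> brings their bounded-Lipschitz norm down to at most 1. They
  connect the metric with the masses of closed sets.\<close>

lemma BL_dist_tendsto_closed_approx:
  fixes C :: "'a::metric_space set"
  assumes "\<And>n. \<mu> n \<in> space (prob_algebra borel)" "\<nu> \<in> space (prob_algebra borel)"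
    "(\<lambda>n. BL_dist (\<mu> n) \<nu>) \<longlonglongrightarrow> 0"
  shows "(\<lambda>n. \<integral>x. max 0 (1 - real k * infdist x C) \<partial>\<mu> n) \<longlonglongrightarrow> (\<integral>x. max 0 (1 - real k * infdist x C) \<partial>\<nu>)"
proof -
  define c where "c = 1 / (1 + real k)"
  define f where "f x = c * max 0 (1 - real k * infdist x C)" for x
  have c: "c > 0" by (simp add: c_def add_pos_nonneg)
  have "BL_norm f \<le> 1"
  proof (rule BL_norm_le_1I[of _ c "c * real k"])
    show "\<bar>f x\<bar> \<le> c" for x
      using c by (simp add: f_def abs_mult infdist_nonneg)
    show "\<bar>f x - f y\<bar> \<le> c * real k * dist x y" for x y
    proof -
      have "\<bar>max 0 (1 - real k * infdist x C) - max 0 (1 - real k * infdist y C)\<bar>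
          \<le> \<bar>real k * infdist x C - real k * infdist y C\<bar>" by linarith
      also have "\<dots> = real k * \<bar>infdist x C - infdist y C\<bar>"
        by (simp add: abs_mult flip: right_diff_distrib)
      also have "\<dots> \<le> real k * dist x y" by (intro mult_left_mono infdist_triangle_abs) auto
      finally have "c * \<bar>max 0 (1 - real k * infdist x C) - max 0 (1 - real k * infdist y C)\<bar>
          \<le> c * (real k * dist x y)"
        using c by (intro mult_left_mono) auto
      then show ?thesis
        using c unfolding f_def right_diff_distrib[symmetric] abs_mult by (simp add: mult.assoc)
    qed
    have "c * (1 + real k) = 1" by (simp add: c_def add_nonneg_eq_0_iff)
    then show "c + c * real k \<le> 1" by (simp add: distrib_left)
  qed (use c in simp)
  from BL_dist_tendsto_integral[OF assms this]
  have "(\<lambda>n. inverse c * (\<integral>x. f x \<partial>\<mu> n)) \<longlonglongrightarrow> inverse c * (\<integral>x. f x \<partial>\<nu>)"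
    by (rule tendsto_mult_left)
  then show ?thesis using c by (simp add: f_def)
qed

text \<open>Closed sets form an intersection-stable generator of the Borel sets, so it suffices that
  \<open>L z C\<close> is measurable in \<open>z\<close> for closed \<open>C\<close>. It is an
  iterated pointwise limit: first in \<open>n\<close> of integrals against the measurable kernels
  \<open>M n\<close>, then in the steepness \<open>k\<close> of the Lipschitz approximants of the
  indicator.\<close>

lemma stochastic_kernels_limit:
  fixes M :: "nat \<Rightarrow> 'x::metric_space \<times> 'u::metric_space \<Rightarrow> 'x measure"
  assumes M: "\<And>n. M n \<in> stochastic_kernels" and L: "\<And>z. L z \<in> space (prob_algebra borel)"
    and lim: "\<And>z. (\<lambda>n. BL_dist (M n z) (L z)) \<longlonglongrightarrow> 0"
  shows "L \<in> stochastic_kernels"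
  unfolding stochastic_kernels_def
proof (rule measurable_prob_algebra_generated[where G = "{C. closed C}" and \<Omega> = UNIV])
  show "sets (borel :: 'x measure) = sigma_sets UNIV {C. closed C}"
    unfolding borel_eq_closed by (rule sets_measure_of) simp
  show "Int_stable {C. closed C}" by (auto simp: Int_stable_def)
  show prob: "prob_space (L z)" and "sets (L z) = sets borel" for z
    using L[of z] by (auto simp: space_prob_algebra)
  fix C :: "'x set" assume "C \<in> {C. closed C}"
  then have C: "closed C" by simp
  have "(\<lambda>z. measure (L z) C) \<in> borel_measurable borel"
  \<comment> \<open>For empty \<open>C\<close> the approximants are constantly 1 and do not tend to
    the indicator, hence the separate case.\<close>
  proof (cases "C = {}")
    case False
    show ?thesis
    proof (rule borel_measurable_LIMSEQ_real)
      show "(\<lambda>k. \<integral>x. max 0 (1 - real k * infdist x C) \<partial>L z) \<longlonglongrightarrow> measure (L z) C" for z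
        by (rule closed_approx_integral[OF C False L])
      show "(\<lambda>z. \<integral>x. max 0 (1 - real k * infdist x C) \<partial>L z) \<in> borel_measurable borel" for k
      proof (rule borel_measurable_LIMSEQ_real)
        show "(\<lambda>n. \<integral>x. max 0 (1 - real k * infdist x C) \<partial>M n z)
            \<longlonglongrightarrow> (\<integral>x. max 0 (1 - real k * infdist x C) \<partial>L z)" for z
          by (rule BL_dist_tendsto_closed_approx[OF stochastic_kernels_space[OF M] L lim])
        show "(\<lambda>z. \<integral>x. max 0 (1 - real k * infdist x C) \<partial>M n z) \<in> borel_measurable borel" for n
        proof -
          have "M n \<in> borel \<rightarrow>\<^sub>M subprob_algebra borel"
            using M[of n] unfolding stochastic_kernels_def by (rule measurable_prob_algebraD)
          moreover have "(\<lambda>x. max 0 (1 - real k * infdist x C)) \<in> borel_measurable borel"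
            by (intro borel_measurable_continuous_onI continuous_intros)
          ultimately show ?thesis
            by (rule measurable_compose[OF _ integral_measurable_subprob_algebra])
        qed
      qed
    qed
  qed simp
  then show "(\<lambda>z. emeasure (L z) C) \<in> borel_measurable borel"
    using prob by (simp add: finite_measure.emeasure_eq_measure prob_space.finite_measure)
qed auto

text \<open>Completeness of the space of measures gives a limit \<open>L z\<close> at each point,
  and the preceding lemma makes \<open>L\<close> a kernel. Convergence is uniform because the Cauchy
  bound passes to the limit with an index independent of \<open>z\<close>.\<close>

lemma mcomplete_stochastic_kernels:
  assumes comp: "compact (UNIV :: 'x::polish_space set)"
  shows "Metric_space.mcomplete (stochastic_kernels :: ('x \<times> 'u::metric_space \<Rightarrow> 'x measure) set) BL_dist_unif"
proof -
  interpret Metric_space "stochastic_kernels :: ('x \<times> 'u \<Rightarrow> 'x measure) set" BL_dist_unif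
    by (rule Metric_space_BL_dist_unif)
  show ?thesis
    unfolding mcomplete_def
  proof (intro allI impI)
    fix M :: "nat \<Rightarrow> 'x \<times> 'u \<Rightarrow> 'x measure" assume cau: "MCauchy M"
    then have M: "M n \<in> stochastic_kernels" for n by (auto simp: MCauchy_def)
    note Mz = stochastic_kernels_space[OF M]
    have unif: "\<exists>N. \<forall>m\<ge>N. \<forall>n\<ge>N. BL_dist_unif (M m) (M n) < e" if "e > 0" for e
      using cau that by (simp add: MCauchy_def)
    have "\<exists>\<nu>. \<nu> \<in> space (prob_algebra borel) \<and> (\<lambda>n. BL_dist (M n z) \<nu>) \<longlonglongrightarrow> 0" for z
    proof -
      have "\<exists>N. \<forall>m\<ge>N. \<forall>n\<ge>N. BL_dist (M m z) (M n z) < e" if "e > 0" for e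
        using unif[OF that] BL_dist_unif_upper[OF M M] by (meson le_less_trans)
      then obtain \<nu> where "\<nu> \<in> space (prob_algebra borel)" "(\<lambda>n. BL_dist (M n z) \<nu>) \<longlonglongrightarrow> 0"
        by (rule BL_dist_complete[OF comp Mz])
      then show ?thesis by blast
    qed
    then obtain L where L: "\<And>z. L z \<in> space (prob_algebra borel)"
      and lim: "\<And>z. (\<lambda>n. BL_dist (M n z) (L z)) \<longlonglongrightarrow> 0" by metis
    have Lk: "L \<in> stochastic_kernels" by (rule stochastic_kernels_limit[OF M L lim])
    have "\<exists>N. \<forall>n\<ge>N. M n \<in> stochastic_kernels \<and> BL_dist_unif (M n) L < e" if "e > 0" for e
    proof -
      obtain N where N: "\<And>m n. m \<ge> N \<Longrightarrow> n \<ge> N \<Longrightarrow> BL_dist_unif (M m) (M n) < e / 2"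
        using unif[of "e / 2"] \<open>e > 0\<close> by auto
      \<comment> \<open>Strict inequalities become weak ones in the limit in \<open>n\<close> and in
        the supremum over \<open>z\<close>; working with \<open>e / 2\<close> leaves room for a
        strict bound by \<open>e\<close>.\<close>
      have "BL_dist (M m z) (L z) \<le> e / 2" if "m \<ge> N" for m z
      proof (rule LIMSEQ_le_const)
        show "(\<lambda>n. e / 2 + BL_dist (M n z) (L z)) \<longlonglongrightarrow> e / 2"
          using tendsto_add[OF tendsto_const lim] by simp
        have "BL_dist (M m z) (L z) \<le> e / 2 + BL_dist (M n z) (L z)" if "n \<ge> N" for n
          using BL_dist_triangle[OF Mz Mz L, of m z z n z] BL_dist_unif_upper[OF M M, of m z n]
            N[OF \<open>m \<ge> N\<close> that] by linarith
        then show "\<exists>N. \<forall>n\<ge>N. BL_dist (M m z) (L z) \<le> e / 2 + BL_dist (M n z) (L z)" by blast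
      qed
      then have "BL_dist_unif (M m) L \<le> e / 2" if "m \<ge> N" for m
        using that by (intro BL_dist_unif_least M Lk)
      then have "BL_dist_unif (M m) L < e" if "m \<ge> N" for m
        using that \<open>e > 0\<close> by fastforce
      then show ?thesis using M by blast
    qed
    then show "\<exists>L. limitin mtopology M L sequentially"
      using Lk unfolding limit_metric_sequentially by blast
  qed
qed

section \<open>Total boundedness\<close>

text \<open>One representative from each fibre of \<open>\<Phi>\<close> forms a finite net whose
  centres lie in \<open>S\<close>, as total boundedness requires.\<close>

lemma (in Metric_space) mtotally_bounded_if_finite_invariant:
  assumes "S \<subseteq> M"
    "\<And>e. e > 0 \<Longrightarrow> \<exists>\<Phi> :: 'a \<Rightarrow> 'b. finite (\<Phi> ` S) \<and> (\<forall>x\<in>S. \<forall>y\<in>S. \<Phi> x = \<Phi> y \<longrightarrow> d x y < e)"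
  shows "mtotally_bounded S"
  unfolding mtotally_bounded_def
proof (intro allI impI)
  fix e :: real assume "e > 0"
  then obtain \<Phi> :: "'a \<Rightarrow> 'b" where fin: "finite (\<Phi> ` S)"
    and \<Phi>: "\<And>x y. x \<in> S \<Longrightarrow> y \<in> S \<Longrightarrow> \<Phi> x = \<Phi> y \<Longrightarrow> d x y < e"
    using assms(2) by blast
  let ?r = "inv_into S \<Phi>"
  have "x \<in> mball (?r (\<Phi> x)) e" if "x \<in> S" for x
  proof -
    have "?r (\<Phi> x) \<in> S" "\<Phi> (?r (\<Phi> x)) = \<Phi> x"
      using that by (auto intro: inv_into_into f_inv_into_f)
    then show ?thesis using \<Phi> that assms(1) by auto
  qed
  then show "\<exists>K. finite K \<and> K \<subseteq> S \<and> S \<subseteq> (\<Union>x\<in>K. mball x e)"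
    using fin by (intro exI[of _ "?r ` \<Phi> ` S"]) (blast intro: inv_into_into)
qed

text \<open>A finite subcover by balls is numbered, and \<open>q x\<close> is the least number of a
  ball containing \<open>x\<close>. Its level sets are disjoint Borel cells, with \<open>p i\<close>
  a centre for cell \<open>i\<close>.\<close>

lemma compact_finite_borel_quantizer:
  assumes comp: "compact (UNIV :: 'a::metric_space set)" and "e > 0"
  obtains q :: "'a::metric_space \<Rightarrow> nat" and p :: "nat \<Rightarrow> 'a" and k
  where "q \<in> borel \<rightarrow>\<^sub>M count_space UNIV" "\<And>x. q x < k" "\<And>x. dist (p (q x)) x < e"
proof -
  have "UNIV \<subseteq> (\<Union>x\<in>UNIV. ball x e)" using \<open>e > 0\<close> by auto
  then obtain D :: "'a set" where "finite D" and D: "UNIV \<subseteq> (\<Union>x\<in>D. ball x e)"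
    using compactE_image[OF comp, of UNIV "\<lambda>x. ball x e"] by auto
  then obtain k p where p: "D = p ` {i::nat. i < k}"
    using finite_imp_nat_seg_image_inj_on by metis
  define q where "q x = (LEAST i. dist (p i) x < e)" for x
  have ex: "\<exists>i<k. dist (p i) x < e" for x using D p by (auto simp: subset_iff)
  show ?thesis
  proof
    show "q \<in> borel \<rightarrow>\<^sub>M count_space UNIV" unfolding q_def
      by (intro measurable_Least borel_measurable_pred_less borel_measurable_continuous_onI continuous_intros)
    show "q x < k" for x
      using ex[of x] Least_le[of "\<lambda>i. dist (p i) x < e"] unfolding q_def by (metis le_less_trans)
    show "dist (p (q x)) x < e" for x
      using ex[of x] LeastI[of "\<lambda>i. dist (p i) x < e"] unfolding q_def by metis
  qed
qed

text \<open>A test function is 1-Lipschitz, so replacing it by its values at the cell centres costs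
  at most \<open>e / 3\<close> under each of the two measures. It is also bounded by 1, so
  \<open>k\<close> cell masses known up to \<open>1 / real N\<close> contribute at most
  \<open>k / N\<close>, a third error below \<open>e / 3\<close>.\<close>

lemma prob_algebra_finite_invariant:
  assumes comp: "compact (UNIV :: 'a::metric_space set)" and "e > 0"
  obtains \<Phi> :: "'a::metric_space measure \<Rightarrow> nat \<Rightarrow> int" where "finite (\<Phi> ` space (prob_algebra borel))"
    "\<And>\<mu> \<nu>. \<mu> \<in> space (prob_algebra borel) \<Longrightarrow> \<nu> \<in> space (prob_algebra borel) \<Longrightarrow> \<Phi> \<mu> = \<Phi> \<nu>
      \<Longrightarrow> BL_dist \<mu> \<nu> \<le> e"
proof -
  obtain q :: "'a \<Rightarrow> nat" and p k where q[measurable]: "q \<in> borel \<rightarrow>\<^sub>M count_space UNIV"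
    and qk: "\<And>x. q x < k" and pq: "\<And>x. dist (p (q x)) x < e / 3"
    by (rule compact_finite_borel_quantizer[OF comp divide_pos_pos[OF \<open>e > 0\<close> zero_less_numeral]]) (rule that)
  define A where "A i = {x. q x = i}" for i
  have A[measurable]: "A i \<in> sets borel" for i unfolding A_def by measurable
  \<comment> \<open>This is the condition \<open>k / N < e / 3\<close> on the total rounding
    error.\<close>
  obtain N :: nat where N: "3 * real k / e < real N" using reals_Archimedean2 by blast
  have "0 \<le> 3 * real k / e" using \<open>e > 0\<close> by simp
  then have "N > 0" using N by (cases N) auto
  define \<Phi> where "\<Phi> \<mu> = restrict (\<lambda>i. \<lfloor>real N * measure \<mu> (A i)\<rfloor>) {..<k}" for \<mu> :: "'a measure"
  show ?thesis
  proof (rule that[of \<Phi>])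
    have "\<Phi> \<mu> \<in> PiE {..<k} (\<lambda>_. {0..int N})" if "\<mu> \<in> space (prob_algebra borel)" for \<mu>
    proof -
      interpret prob_space \<mu> using that by (simp add: space_prob_algebra)
      have "real N * prob (A i) < real N + 1" for i
        using mult_left_le[OF prob_le_1, of "real N" "A i"] by simp
      then show ?thesis by (auto simp: \<Phi>_def floor_le_iff)
    qed
    then have "\<Phi> ` space (prob_algebra borel) \<subseteq> PiE {..<k} (\<lambda>_. {0..int N})" by blast
    then show "finite (\<Phi> ` space (prob_algebra borel))"
      by (rule finite_subset) (intro finite_PiE; simp)
    fix \<mu> \<nu> :: "'a measure"
    assume \<mu>: "\<mu> \<in> space (prob_algebra borel)" and \<nu>: "\<nu> \<in> space (prob_algebra borel)"
      and eq: "\<Phi> \<mu> = \<Phi> \<nu>"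
    have close: "\<bar>measure \<mu> (A i) - measure \<nu> (A i)\<bar> \<le> 1 / real N" if "i < k" for i
    proof -
      have "\<lfloor>real N * measure \<mu> (A i)\<rfloor> = \<lfloor>real N * measure \<nu> (A i)\<rfloor>"
        using fun_cong[OF eq, of i] that by (simp add: \<Phi>_def)
      then have "\<bar>real N * measure \<mu> (A i) - real N * measure \<nu> (A i)\<bar> \<le> 1" by linarith
      then have "real N * \<bar>measure \<mu> (A i) - measure \<nu> (A i)\<bar> \<le> 1"
        by (simp add: abs_mult flip: right_diff_distrib)
      then show ?thesis using \<open>N > 0\<close> by (simp add: field_simps)
    qed
    show "BL_dist \<mu> \<nu> \<le> e"
    proof (rule BL_dist_least[OF \<mu> \<nu>])
      fix f :: "'a \<Rightarrow> real" assume f: "BL_norm f \<le> 1"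
      have [measurable]: "f \<in> borel_measurable borel"
        using BL_norm_le_1_continuous[OF f] by (rule borel_measurable_continuous_onI)
      have [measurable]: "(\<lambda>x. f (p (q x))) \<in> borel_measurable borel"
        by (rule measurable_compose[OF q]) simp
      \<comment> \<open>The sum is the integral of \<open>f (p (q x))\<close>, which is constant on
        each cell and differs from \<open>f x\<close> by at most the distance from \<open>x\<close>
        to its centre.\<close>
      have approx: "\<bar>(\<integral>x. f x \<partial>\<kappa>) - (\<Sum>i<k. f (p i) * measure \<kappa> (A i))\<bar> \<le> e / 3"
        if \<kappa>: "\<kappa> \<in> space (prob_algebra borel)" for \<kappa>
      proof -
        have [simp, measurable_cong]: "sets \<kappa> = sets borel" and "prob_space \<kappa>"
          using \<kappa> by (auto simp: space_prob_algebra)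
        interpret prob_space \<kappa> by fact
        have int: "integrable \<kappa> f" "integrable \<kappa> (\<lambda>x. f (p (q x)))"
          using BL_norm_le_1D(1)[OF f] by (auto intro!: bounded_measurable_integrable[OF \<kappa>, of _ 1])
        have "(\<integral>x. f (p (q x)) \<partial>\<kappa>) = (\<integral>x. (\<Sum>i<k. f (p i) * indicator (A i) x) \<partial>\<kappa>)"
          using qk by (intro Bochner_Integration.integral_cong)
            (auto simp: A_def indicator_def if_distrib cong: if_cong)
        also have "\<dots> = (\<Sum>i<k. \<integral>x. f (p i) * indicator (A i) x \<partial>\<kappa>)"
          by (intro Bochner_Integration.integral_sum integrable_mult_right integrable_real_indicator)
            (auto simp: less_top[symmetric])
        also have "\<dots> = (\<Sum>i<k. f (p i) * measure \<kappa> (A i))" by simp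
        finally have sum: "(\<integral>x. f (p (q x)) \<partial>\<kappa>) = (\<Sum>i<k. f (p i) * measure \<kappa> (A i))" .
        have "\<bar>f x - f (p (q x))\<bar> \<le> e / 3" for x
          using BL_norm_le_1D(2)[OF f, of x "p (q x)"] pq[of x] by (simp add: dist_commute)
        then have "(\<integral>x. \<bar>f x - f (p (q x))\<bar> \<partial>\<kappa>) \<le> (\<integral>x. e / 3 \<partial>\<kappa>)"
          using int by (intro integral_mono) auto
        then have "\<bar>\<integral>x. f x - f (p (q x)) \<partial>\<kappa>\<bar> \<le> e / 3"
          using integral_abs_bound[of \<kappa> "\<lambda>x. f x - f (p (q x))"]
          unfolding lebesgue_integral_const prob_space real_scaleR_def by linarith
        then show ?thesis using int sum by simp
      qed
      have "\<bar>(\<Sum>i<k. f (p i) * measure \<mu> (A i)) - (\<Sum>i<k. f (p i) * measure \<nu> (A i))\<bar>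
          = \<bar>\<Sum>i<k. f (p i) * (measure \<mu> (A i) - measure \<nu> (A i))\<bar>"
        by (simp add: sum_subtractf right_diff_distrib)
      also have "\<dots> \<le> (\<Sum>i<k. \<bar>f (p i) * (measure \<mu> (A i) - measure \<nu> (A i))\<bar>)" by (rule sum_abs)
      also have "\<dots> \<le> (\<Sum>i<k. 1 / real N)"
      proof (rule sum_mono)
        fix i assume "i \<in> {..<k}"
        then have "\<bar>f (p i)\<bar> * \<bar>measure \<mu> (A i) - measure \<nu> (A i)\<bar> \<le> 1 * (1 / real N)"
          using close BL_norm_le_1D(1)[OF f] by (intro mult_mono) auto
        then show "\<bar>f (p i) * (measure \<mu> (A i) - measure \<nu> (A i))\<bar> \<le> 1 / real N"
          by (simp add: abs_mult)
      qed
      also have "\<dots> \<le> e / 3" using N \<open>N > 0\<close> \<open>e > 0\<close> by (simp add: field_simps)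
      finally show "\<bar>(\<integral>x. f x \<partial>\<mu>) - (\<integral>x. f x \<partial>\<nu>)\<bar> \<le> e"
        using approx[OF \<mu>] approx[OF \<nu>] by linarith
    qed
  qed
qed

section \<open>Equicontinuous families of kernels\<close>

text \<open>By compactness finitely many balls of equicontinuity cover the product. The finite
  invariants of the measures \<open>M z\<close> at their centres, taken together, determine
  \<open>M\<close> uniformly up to a small error.\<close>

lemma weakly_equicontinuous_mtotally_bounded:
  fixes \<M> :: "('x::metric_space \<times> 'u::metric_space \<Rightarrow> 'x measure) set"
  assumes compX: "compact (UNIV :: 'x set)" and compU: "compact (UNIV :: 'u set)"
    and \<M>: "\<M> \<subseteq> stochastic_kernels" and equi: "weakly_equicontinuous \<M>"
  shows "Metric_space.mtotally_bounded stochastic_kernels BL_dist_unif \<M>"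
proof -
  interpret Metric_space "stochastic_kernels :: ('x \<times> 'u \<Rightarrow> 'x measure) set" BL_dist_unif
    by (rule Metric_space_BL_dist_unif)
  show ?thesis
  proof (rule mtotally_bounded_if_finite_invariant[OF \<M>, where 'b = "'x \<times> 'u \<Rightarrow> nat \<Rightarrow> int"])
    fix e :: real assume "e > 0"
    have "\<exists>\<delta>>0. \<forall>w. dist z w < \<delta> \<longrightarrow> (\<forall>M\<in>\<M>. BL_dist (M z) (M w) \<le> e / 4)" for z
      using equi \<open>e > 0\<close> unfolding weakly_equicontinuous_def split_paired_All
      by (cases z) (metis divide_pos_pos zero_less_numeral)
    then obtain \<delta> where \<delta>: "\<And>z. \<delta> z > 0"
      "\<And>z w M. dist z w < \<delta> z \<Longrightarrow> M \<in> \<M> \<Longrightarrow> BL_dist (M z) (M w) \<le> e / 4" by metis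
    have comp: "compact (UNIV :: ('x \<times> 'u) set)"
      using compact_Times[OF compX compU] by simp
    have "UNIV \<subseteq> (\<Union>z\<in>UNIV. ball z (\<delta> z))" by (auto simp: \<delta>(1))
    then obtain Z where "finite Z" and Z: "UNIV \<subseteq> (\<Union>z\<in>Z. ball z (\<delta> z))"
      using compactE_image[OF comp, of UNIV "\<lambda>z. ball z (\<delta> z)"] by auto
    obtain \<Phi> :: "'x measure \<Rightarrow> nat \<Rightarrow> int" where fin: "finite (\<Phi> ` space (prob_algebra borel))"
      and \<Phi>: "\<And>\<mu> \<nu>. \<mu> \<in> space (prob_algebra borel) \<Longrightarrow> \<nu> \<in> space (prob_algebra borel) \<Longrightarrow> \<Phi> \<mu> = \<Phi> \<nu>
        \<Longrightarrow> BL_dist \<mu> \<nu> \<le> e / 4"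
      using prob_algebra_finite_invariant[OF compX, of "e / 4"] \<open>e > 0\<close> by auto
    define \<Psi> where "\<Psi> M = restrict (\<lambda>z. \<Phi> (M z)) Z" for M :: "'x \<times> 'u \<Rightarrow> 'x measure"
    note space = stochastic_kernels_space[OF subsetD[OF \<M>]]
    have "\<Psi> ` \<M> \<subseteq> PiE Z (\<lambda>_. \<Phi> ` space (prob_algebra borel))"
      using space by (auto simp: \<Psi>_def)
    then have "finite (\<Psi> ` \<M>)"
      by (rule finite_subset) (intro finite_PiE \<open>finite Z\<close> fin)
    moreover have "BL_dist_unif M M' < e" if M: "M \<in> \<M>" and M': "M' \<in> \<M>" and eq: "\<Psi> M = \<Psi> M'" for M M'
    proof -
      \<comment> \<open>The path runs from \<open>M w\<close> to \<open>M z\<close>, across to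
        \<open>M' z\<close> and back to \<open>M' w\<close>, with \<open>e / 4\<close> for each leg.
        Three quarters of \<open>e\<close> keep the supremum over \<open>w\<close> strictly below
        \<open>e\<close>.\<close>
      have "BL_dist (M w) (M' w) \<le> 3 * (e / 4)" for w
      proof -
        have "w \<in> (\<Union>z\<in>Z. ball z (\<delta> z))" using Z by blast
        then obtain z where z: "z \<in> Z" "dist z w < \<delta> z" unfolding UN_iff mem_ball by blast
        have "\<Phi> (M z) = \<Phi> (M' z)" using fun_cong[OF eq, of z] z(1) by (simp add: \<Psi>_def)
        then have "BL_dist (M z) (M' z) \<le> e / 4" by (intro \<Phi> space M M')
        moreover have "BL_dist (M w) (M z) \<le> e / 4"
          using \<delta>(2)[OF z(2) M] by (simp add: BL_dist_commute)
        moreover have "BL_dist (M' z) (M' w) \<le> e / 4" by (rule \<delta>(2)[OF z(2) M'])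
        ultimately show ?thesis
          using BL_dist_triangle[OF space[OF M] space[OF M] space[OF M'], of w w z]
            BL_dist_triangle[OF space[OF M] space[OF M'] space[OF M'], of z w z] by linarith
      qed
      then have "BL_dist_unif M M' \<le> 3 * (e / 4)"
        using M M' \<M> by (intro BL_dist_unif_least) auto
      then show ?thesis using \<open>e > 0\<close> by linarith
    qed
    ultimately show "\<exists>\<Psi> :: _ \<Rightarrow> 'x \<times> 'u \<Rightarrow> nat \<Rightarrow> int. finite (\<Psi> ` \<M>)
        \<and> (\<forall>M\<in>\<M>. \<forall>M'\<in>\<M>. \<Psi> M = \<Psi> M' \<longrightarrow> BL_dist_unif M M' < e)"
      by blast
  qed
qed

theorem theorem2p12:
  fixes \<M> :: "('x::polish_space \<times> 'u::polish_space \<Rightarrow> 'x measure) set"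
  assumes "compact (UNIV :: 'x set)" and "compact (UNIV :: 'u set)"
    and "\<M> \<subseteq> stochastic_kernels"
    and "weakly_equicontinuous \<M>"
  shows "compactin kernel_topology (kernel_topology closure_of \<M>)"
  unfolding kernel_topology_def
  \<comment> \<open>In a complete metric space, a subset is totally bounded exactly when its closure
    is compact.\<close>
  using Metric_space.mtotally_bounded_eq_compact_closure_of[OF Metric_space_BL_dist_unif
      mcomplete_stochastic_kernels[OF assms(1)]]
    weakly_equicontinuous_mtotally_bounded[OF assms]
  by blast

end
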